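(* Suppose that, for every state-action pair $(s,a)$ and every $i\in\{1,\dots,N\}$, $Q^i_{sa}=Q^*_{sa}+e^i_{sa}$, where the random approximation error $e^i_{sa}$ is a uniform random variable $U(-\tau,\tau)$ for some $\tau>0$. Let $M$ be the number of actions applicable at state $s'$, and assume that all actions share the same true action-value. Put $Q^{\min}_{sa}=\min_{i\in\{1,\dots,N\}}Q^i_{sa}=Q^*_{sa}+\min_{i\in\{1,\dots,N\}}e^i_{sa}$, and for a transition $(s,a,r,s')$ define the estimation bias $$Z_{MN}=\Big(r+\gamma\max_{a'}Q^{\min}_{s'a'}\Big)-\Big(r+\gamma\max_{a'}Q^*_{s'a'}\Big)=\gamma\Big(\max_{a'}Q^{\min}_{s'a'}-\max_{a'}Q^*_{s'a'}\Big).$$ Then: (i) the expected estimation bias is $$E[Z_{MN}]=\gamma\tau\,[1-2t_{MN}],\qquad\text{where } t_{MN}=\frac{M(M-1)\cdots 1}{(M+\frac1N)(M-1+\frac1N)\cdots(1+\frac1N)}.$$ $E[Z_{MN}]$ decreases as $N$ increases: $E[Z_{M,N=1}]=\gamma\tau\frac{M-1}{M+1}$ and $E[Z_{M,N\to\infty}]=-\gamma\tau$. (ii) $$\mathrm{Var}[Q^{\min}_{sa}]=\frac{4N\tau^2}{(N+1)^2(N+2)}.$$ $\mathrm{Var}[Q^{\min}_{sa}]$ decreases as $N$ increases: $\mathrm{Var}[Q^{\min}_{sa}]=\frac{\tau^2}{3}$ for $N=1$ and $\mathrm{Var}[Q^{\min}_{sa}]=0$ for $N\to\infty$.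
   Context: In Maxmin Q-learning one maintains $N$ estimates $Q^1,\dots,Q^N$ of the optimal action values $Q^*$ of a Markov decision process with discount factor $\gamma\in[0,1]$; the update target for a transition $(s,a,r,s')$ (state, action, reward, next state) is $r+\gamma\max_{a'}\min_{i}Q^i(s',a')$. The algorithm uses random subsamples of the observed data for each of the $N$ estimators, to make them nearly independent. $Q_{sa}$ abbreviates $Q(s,a)$; maxima over $a'$ are over the $M$ actions applicable at $s'$. $N$ is a positive integer, and $\tau$ is treated as a generic constant.
   Formalization: The errors at each state are assumed jointly independent over the estimators i and the actions a; the statement leaves this implicit, and without it the formulas fail (e.g. identical errors for all i give variance τ²/3 for every N). *)

theory Defs
  imports "HOL-Probability.Probability"
begin

definition Qmin :: "nat \<Rightarrow> (nat \<Rightarrow> 's \<Rightarrow> 'a \<Rightarrow> 'w \<Rightarrow> real) \<Rightarrow> 's \<Rightarrow> 'a \<Rightarrow> 'w \<Rightarrow> real" where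
  "Qmin N Q s a \<omega> = (MIN i\<in>{1..N}. Q i s a \<omega>)"

text \<open>
  Estimation bias at a transition with reward \<open>r\<close> and next state \<open>s'\<close>. The current state and
  action of the transition do not enter the update target.
\<close>

definition estimation_bias ::
  "real \<Rightarrow> ('s \<Rightarrow> 'a set) \<Rightarrow> ('s \<Rightarrow> 'a \<Rightarrow> real) \<Rightarrow> real \<Rightarrow> 's \<Rightarrow> nat
    \<Rightarrow> (nat \<Rightarrow> 's \<Rightarrow> 'a \<Rightarrow> 'w \<Rightarrow> real) \<Rightarrow> 'w \<Rightarrow> real" where
  "estimation_bias \<gamma> A Qstar r s' N Q \<omega> =
     (r + \<gamma> * (MAX a'\<in>A s'. Qmin N Q s' a' \<omega>)) - (r + \<gamma> * (MAX a'\<in>A s'. Qstar s' a'))"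

definition t_MN :: "nat \<Rightarrow> nat \<Rightarrow> real" where
  "t_MN M N = (\<Prod>k=1..M. real k) / (\<Prod>k=1..M. (real k + 1 / real N))"

text \<open>
  \<open>N\<close> noisy estimates \<open>Q 1, \<dots>, Q N\<close> of \<open>Qstar\<close> over the state-action pairs \<open>(s, a)\<close> with
  \<open>a \<in> A s\<close>. Independence is required over estimators and actions jointly, but only within
  each state.
\<close>

locale maxmin_estimates = prob_space P
  for P :: "'w measure" +
  fixes \<tau> :: real
    and A :: "'s \<Rightarrow> 'a set"
    and Qstar :: "'s \<Rightarrow> 'a \<Rightarrow> real"
    and N :: nat
    and Q e :: "nat \<Rightarrow> 's \<Rightarrow> 'a \<Rightarrow> 'w \<Rightarrow> real"
  assumes N_pos: "N \<ge> 1"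
    and \<tau>_pos: "\<tau> > 0"
    and Q_eq: "\<And>i s a \<omega>. i \<in> {1..N} \<Longrightarrow> a \<in> A s \<Longrightarrow> \<omega> \<in> space P \<Longrightarrow>
          Q i s a \<omega> = Qstar s a + e i s a \<omega>"
    and error_uniform: "\<And>i s a. i \<in> {1..N} \<Longrightarrow> a \<in> A s \<Longrightarrow>
          distributed P lborel (e i s a)
            (\<lambda>x. indicator {-\<tau>..\<tau>} x / measure lborel {-\<tau>..\<tau>})"
    and error_indep: "\<And>s. indep_vars (\<lambda>_. borel) (\<lambda>(i, a). e i s a) ({1..N} \<times> A s)"

end

theory Submission
  imports Defs "HOL-Real_Asymp.Real_Asymp"
begin

text \<open>
  Since all actions share the same true value, the bias is \<open>\<gamma>\<close> times the maximum \<open>Y\<close> over the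
  \<open>M\<close> actions of the minimum over the \<open>N\<close> errors. With \<open>V = (\<tau> - Y) / (2\<tau>)\<close>, independence gives
  \<open>P(V \<ge> v) = (1 - v^N)^M\<close> on \<open>[0,1]\<close>, so \<open>E V = \<integral>\<^sub>0\<^sup>1 (1 - v^N)^M dv\<close>. Integration by parts yields a
  recursion in \<open>M\<close> whose solution is \<open>t\<^sub>M\<^sub>N\<close>. For the variance take \<open>M = 1\<close> and
  \<open>E V^2 = \<integral>\<^sub>0\<^sup>1 2v (1 - v^N) dv = N / (N + 2)\<close>.
\<close>

section \<open>Moments from tails\<close>

lemma (in prob_space) integrable_power_unit_interval:
  fixes V :: "'a \<Rightarrow> real"
  assumes [measurable]: "random_variable borel V" and AE: "AE \<omega> in M. 0 \<le> V \<omega> \<and> V \<omega> \<le> 1"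
  shows "integrable M (\<lambda>\<omega>. V \<omega> ^ p)"
proof (rule integrable_const_bound[where B=1])
  show "AE \<omega> in M. norm (V \<omega> ^ p) \<le> 1"
    using AE by eventually_elim (auto intro: power_le_one)
qed measurable

text \<open>Layer-cake formula: \<open>V \<omega> ^ Suc p\<close> is the integral of
  \<open>real (Suc p) * v ^ p\<close> over \<open>{0..V \<omega>}\<close>. Tonelli exchanges the
  integrals and leaves the weight times the tail \<open>G\<close>, which the antiderivative
  \<open>H\<close> integrates.\<close>

lemma (in prob_space) expectation_power_tail:
  fixes V G H :: "_ \<Rightarrow> real"
  assumes [measurable]: "random_variable borel V" "G \<in> borel_measurable borel"
    and AE: "AE \<omega> in M. 0 \<le> V \<omega> \<and> V \<omega> \<le> 1"
    and tail: "\<And>v. 0 \<le> v \<Longrightarrow> v \<le> 1 \<Longrightarrow> \<P>(\<omega> in M. v \<le> V \<omega>) = G v"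
    and H: "\<And>v. 0 \<le> v \<Longrightarrow> v \<le> 1 \<Longrightarrow> (H has_real_derivative real (Suc p) * v ^ p * G v) (at v)"
  shows "expectation (\<lambda>\<omega>. V \<omega> ^ Suc p) = H 1 - H 0"
proof -
  interpret pair_sigma_finite M lborel ..
  let ?h = "\<lambda>v. real (Suc p) * v ^ p"
  have G0: "0 \<le> G v" if "0 \<le> v" "v \<le> 1" for v
    using tail[OF that] measure_nonneg by metis
  have "(\<integral>\<^sup>+\<omega>. ennreal (V \<omega> ^ Suc p) \<partial>M)
      = (\<integral>\<^sup>+\<omega>. \<integral>\<^sup>+v. ennreal (?h v) * indicator {0..1} v * indicator {v. v \<le> V \<omega>} v \<partial>lborel \<partial>M)"
  proof (rule nn_integral_cong_AE, use AE in eventually_elim)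
    case (elim \<omega>)
    have "(\<integral>\<^sup>+v. ennreal (?h v) * indicator {0..V \<omega>} v \<partial>lborel) = V \<omega> ^ Suc p - 0 ^ Suc p"
      using elim
      by (intro nn_integral_FTC_Icc[where F="\<lambda>v. v ^ Suc p"])
         (auto intro!: derivative_eq_intros simp del: power_Suc)
    \<comment> \<open>As \<open>V \<omega>\<close> is at most 1, the random interval splits into the
      fixed interval \<open>{0..1}\<close> and a condition linking \<open>v\<close> and
      \<open>\<omega>\<close>, the form in which the order of integration can be exchanged.\<close>
    also have "(\<integral>\<^sup>+v. ennreal (?h v) * indicator {0..V \<omega>} v \<partial>lborel)
      = (\<integral>\<^sup>+v. ennreal (?h v) * indicator {0..1} v * indicator {v. v \<le> V \<omega>} v \<partial>lborel)"
      using elim by (intro nn_integral_cong) (auto split: split_indicator)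
    finally show ?case by simp
  qed
  also have "\<dots> = (\<integral>\<^sup>+v. \<integral>\<^sup>+\<omega>. ennreal (?h v) * indicator {0..1} v * indicator {v. v \<le> V \<omega>} v \<partial>M \<partial>lborel)"
    by (intro Fubini'[symmetric]) measurable
  also have "\<dots> = (\<integral>\<^sup>+v. ennreal (?h v * G v) * indicator {0..1} v \<partial>lborel)"
  proof (rule nn_integral_cong)
    fix v :: real
    have "(\<integral>\<^sup>+\<omega>. ennreal (?h v) * indicator {0..1} v * indicator {v. v \<le> V \<omega>} v \<partial>M)
      = (\<integral>\<^sup>+\<omega>. ennreal (?h v) * indicator {0..1} v * indicator {\<omega>\<in>space M. v \<le> V \<omega>} \<omega> \<partial>M)"
      by (intro nn_integral_cong) (auto split: split_indicator)
    also have "\<dots> = ennreal (?h v) * indicator {0..1} v * emeasure M {\<omega>\<in>space M. v \<le> V \<omega>}"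
      by (intro nn_integral_cmult_indicator) measurable
    also have "\<dots> = ennreal (?h v * G v) * indicator {0..1} v"
      using tail[of v] G0[of v]
      by (auto simp: emeasure_eq_measure ennreal_mult[symmetric] split: split_indicator)
    finally show "(\<integral>\<^sup>+\<omega>. ennreal (?h v) * indicator {0..1} v * indicator {v. v \<le> V \<omega>} v \<partial>M)
      = ennreal (?h v * G v) * indicator {0..1} v" .
  qed
  also have "\<dots> = H 1 - H 0"
    using G0 H by (intro nn_integral_FTC_Icc) auto
  finally have nn: "(\<integral>\<^sup>+\<omega>. ennreal (V \<omega> ^ Suc p) \<partial>M) = ennreal (H 1 - H 0)" .
  \<comment> \<open>\<open>ennreal\<close> sends negative reals to 0, so the sign of the difference
    has to be known before returning to a real expectation.\<close>
  have "H 0 \<le> H 1"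
    by (rule DERIV_nonneg_imp_nondecreasing[of 0 1 H]) (use H G0 in force)+
  then show ?thesis
    using nn AE
    by (subst integral_eq_nn_integral) (auto elim!: eventually_mono simp del: power_Suc)
qed

section \<open>The integral of \<open>(1 - v ^ N) ^ M\<close> over the unit interval\<close>

lemma t_MN_altdef: "t_MN M N = (\<Prod>k=1..M. real k / (real k + 1 / real N))"
  by (simp add: t_MN_def prod_dividef)

text \<open>Phrased with an antiderivative, as \<open>expectation_power_tail\<close> consumes it.
  With \<open>c = (M + 1) * N\<close>, passing from \<open>M\<close> to \<open>M + 1\<close>
  multiplies the integral by \<open>c / (1 + c)\<close>, which equals the new factor
  \<open>(M + 1) / (M + 1 + 1 / N)\<close> of \<open>t_MN\<close>.\<close>

lemma antiderivative_one_minus_power: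
  assumes "N \<ge> 1"
  shows "\<exists>H. (\<forall>v. (H has_real_derivative (1 - v ^ N) ^ M) (at v)) \<and> H 1 - H 0 = t_MN M N"
proof (induction M)
  case 0
  show ?case
    by (rule exI[of _ "\<lambda>v. v"]) (auto simp: t_MN_def)
next
  case (Suc M)
  then obtain H where H: "\<And>v. (H has_real_derivative (1 - v ^ N) ^ M) (at v)"
    and H01: "H 1 - H 0 = t_MN M N" by blast
  define c where "c = real (Suc M) * real N"
  have c: "c > 0" using assms by (simp add: c_def)
  \<comment> \<open>\<open>K\<close> comes from differentiating \<open>v (1 - v^N)^(M + 1)\<close>: the result is a combination of the
    integrands for \<open>M\<close> and \<open>M + 1\<close>.\<close>
  define K where "K v = (v * (1 - v ^ N) ^ Suc M + c * H v) / (1 + c)" for v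
  have "(K has_real_derivative (1 - v ^ N) ^ Suc M) (at v)" for v
  proof -
    have "v * v ^ (N - 1) = v ^ N" using assms by (cases N) auto
    then have "((1 - v ^ N) ^ Suc M + v * (real (Suc M) * (1 - v ^ N) ^ M * (- (real N * v ^ (N - 1)))) + c * (1 - v ^ N) ^ M)
        = (1 - v ^ N) ^ Suc M - c * (v ^ N) * (1 - v ^ N) ^ M + c * (1 - v ^ N) ^ M"
      by (simp add: c_def)
    also have "\<dots> = (1 + c) * (1 - v ^ N) ^ Suc M" by (simp add: algebra_simps)
    finally have "(1 - v ^ N) ^ Suc M =
      ((1 - v ^ N) ^ Suc M + v * (real (Suc M) * (1 - v ^ N) ^ M * (- (real N * v ^ (N - 1)))) + c * (1 - v ^ N) ^ M) / (1 + c)"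
      using c by (simp add: field_simps)
    moreover have "(K has_real_derivative \<dots>) (at v)"
      unfolding K_def[abs_def] using c
      by (auto intro!: derivative_eq_intros H simp del: power_Suc)
    ultimately show ?thesis by simp
  qed
  moreover have "K 1 - K 0 = t_MN (Suc M) N"
  proof -
    \<comment> \<open>The boundary term \<open>v * (1 - v ^ N) ^ Suc M\<close> vanishes at both 0
      and 1.\<close>
    have "K 1 - K 0 = c * (H 1 - H 0) / (1 + c)"
      using assms by (simp add: K_def zero_power diff_divide_distrib[symmetric] right_diff_distrib)
    also have "\<dots> = t_MN M N * (real (Suc M) / (real (Suc M) + 1 / real N))"
      using assms c by (simp add: H01 c_def field_simps)
    finally show ?thesis by (simp add: t_MN_altdef)
  qed
  ultimately show ?case by blast
qed

section \<open>Maxima of minima of independent uniform variables\<close>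

text \<open>The action set \<open>B\<close> is kept general to serve both claims: all actions of the
  next state for the bias, a singleton for the variance of a single minimum.\<close>

locale uniform_errors = prob_space P for P :: "'w measure" +
  fixes \<tau> :: real and N :: nat and B :: "'b set" and e :: "nat \<Rightarrow> 'b \<Rightarrow> 'w \<Rightarrow> real"
  assumes N: "N \<ge> 1" and \<tau>: "\<tau> > 0"
    and B: "finite B" "B \<noteq> {}"
    and uniform: "\<And>i a. i \<in> {1..N} \<Longrightarrow> a \<in> B \<Longrightarrow>
          distributed P lborel (e i a) (\<lambda>x. indicator {-\<tau>..\<tau>} x / measure lborel {-\<tau>..\<tau>})"
    and indep: "indep_vars (\<lambda>_. borel) (\<lambda>(i, a). e i a) ({1..N} \<times> B)"
begin

definition maxmin :: "'w \<Rightarrow> real" where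
  "maxmin \<omega> = (MAX a\<in>B. MIN i\<in>{1..N}. e i a \<omega>)"

text \<open>The reflection \<open>x \<mapsto> (\<tau> - x) / (2\<tau>)\<close> turns the errors into \<open>U(0,1)\<close> variables and
  exchanges minima and maxima, which makes every tail below a polynomial.\<close>

definition V :: "'w \<Rightarrow> real" where
  "V \<omega> = (\<tau> - maxmin \<omega>) / (2 * \<tau>)"

lemma maxmin_eq: "maxmin \<omega> = \<tau> - 2 * \<tau> * V \<omega>"
  using \<tau> by (simp add: V_def)

lemma measurable_e [measurable]: "i \<in> {1..N} \<Longrightarrow> a \<in> B \<Longrightarrow> e i a \<in> borel_measurable P"
  using distributed_measurable[OF uniform[of i a]] by simp

lemma measurable_maxmin [measurable]: "maxmin \<in> borel_measurable P"
  unfolding maxmin_def[abs_def] using B by (intro borel_measurable_Max borel_measurable_Min) auto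

lemma measurable_V [measurable]: "V \<in> borel_measurable P"
  unfolding V_def[abs_def] by measurable

lemma prob_error_greater:
  assumes "i \<in> {1..N}" "a \<in> B" "0 \<le> v" "v \<le> 1"
  shows "\<P>(\<omega> in P. \<tau> - 2 * \<tau> * v < e i a \<omega>) = v"
proof -
  have [measurable]: "e i a \<in> borel_measurable P" using assms by measurable
  \<comment> \<open>This places the threshold \<open>\<tau> - 2 * \<tau> * v\<close> above
    \<open>-\<tau>\<close>, inside the support of the uniform law.\<close>
  have "v * \<tau> \<le> 1 * \<tau>" using assms \<tau> by (intro mult_right_mono) auto
  then have "\<P>(\<omega> in P. e i a \<omega> \<le> \<tau> - 2 * \<tau> * v) = (\<tau> - 2 * \<tau> * v - - \<tau>) / (\<tau> - - \<tau>)"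
    using assms \<tau> by (intro uniform_distributed_measure[OF uniform]) (auto simp: mult.commute)
  also have "\<dots> = 1 - v" using \<tau> by (simp add: field_simps)
  finally have "\<P>(\<omega> in P. \<not> e i a \<omega> \<le> \<tau> - 2 * \<tau> * v) = v"
    by (subst prob_neg) auto
  then show ?thesis by (simp add: not_le)
qed

text \<open>The minima for different actions are measurable functions of disjoint blocks
  \<open>{1..N} \<times> {a}\<close> of one jointly independent family.\<close>

lemma indep_mins: "indep_vars (\<lambda>_. borel) (\<lambda>a \<omega>. MIN i\<in>{1..N}. e i a \<omega>) B"
proof -
  let ?K = "\<lambda>a. {1..N} \<times> {a}"
  have "indep_vars (\<lambda>a. PiM (?K a) (\<lambda>_. borel))
      (\<lambda>a \<omega>. restrict (\<lambda>p. (case p of (i, a) \<Rightarrow> e i a) \<omega>) (?K a)) B"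
    by (rule indep_vars_restrict[OF indep]) (auto simp: disjoint_family_on_def)
  then have "indep_vars (\<lambda>_. borel)
      (\<lambda>a \<omega>. MIN i\<in>{1..N}. restrict (\<lambda>p. (case p of (i, a) \<Rightarrow> e i a) \<omega>) (?K a) (i, a)) B"
    by (rule indep_vars_compose2[where Y="\<lambda>a f. MIN i\<in>{1..N}. f (i, a)"])
       (auto intro!: borel_measurable_Min measurable_component_singleton)
  also have "?this \<longleftrightarrow> ?thesis"
    by (intro indep_vars_cong refl) (auto intro!: arg_cong[where f=Min] image_cong)
  finally show ?thesis .
qed

text \<open>The complement factorises: a minimum exceeds the threshold iff all \<open>N\<close>
  independent errors do, each with probability \<open>v\<close>.\<close>

lemma prob_min_le:
  assumes "a \<in> B" "0 \<le> v" "v \<le> 1"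
  shows "\<P>(\<omega> in P. (MIN i\<in>{1..N}. e i a \<omega>) \<le> \<tau> - 2 * \<tau> * v) = 1 - v ^ N"
proof -
  let ?y = "\<tau> - 2 * \<tau> * v"
  have ne: "{1..N} \<noteq> {}" using N by auto
  have meas [measurable]: "(\<lambda>\<omega>. MIN i\<in>{1..N}. e i a \<omega>) \<in> borel_measurable P"
    using assms by (intro borel_measurable_Min) auto
  have "\<P>(\<omega> in P. \<not> (MIN i\<in>{1..N}. e i a \<omega>) \<le> ?y) =
      prob (\<Inter>p\<in>{1..N} \<times> {a}. (case p of (i, a) \<Rightarrow> e i a) -` {?y<..} \<inter> space P)"
    using N ne by (intro arg_cong[where f=prob]) (auto simp: not_le)
  also have "\<dots> = (\<Prod>p\<in>{1..N} \<times> {a}. prob ((case p of (i, a) \<Rightarrow> e i a) -` {?y<..} \<inter> space P))"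
    using assms ne by (intro indep_varsD[OF indep]) auto
  also have "\<dots> = (\<Prod>p\<in>{1..N} \<times> {a}. v)"
  proof (intro prod.cong refl)
    fix p assume "p \<in> {1..N} \<times> {a}"
    then obtain i where i: "p = (i, a)" "i \<in> {1..N}" by auto
    have "prob (e i a -` {?y<..} \<inter> space P) = \<P>(\<omega> in P. ?y < e i a \<omega>)"
      by (intro arg_cong[where f=prob]) auto
    then show "prob ((case p of (i, a) \<Rightarrow> e i a) -` {?y<..} \<inter> space P) = v"
      using prob_error_greater[OF i(2) assms] i by simp
  qed
  also have "\<dots> = v ^ N" by simp
  finally have "\<P>(\<omega> in P. \<not> (MIN i\<in>{1..N}. e i a \<omega>) \<le> ?y) = v ^ N" .
  moreover have ev: "{\<omega> \<in> space P. (MIN i\<in>{1..N}. e i a \<omega>) \<le> ?y} \<in> events"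
    using meas by (rule borel_measurable_le[OF _ borel_measurable_const])
  ultimately show ?thesis using prob_neg[OF ev] by linarith
qed

text \<open>Reflection reverses the order, so the event says that the maximum, hence each of the
  \<open>card B\<close> independent minima, lies below the threshold.\<close>

lemma prob_V_ge:
  assumes "0 \<le> v" "v \<le> 1"
  shows "\<P>(\<omega> in P. v \<le> V \<omega>) = (1 - v ^ N) ^ card B"
proof -
  let ?y = "\<tau> - 2 * \<tau> * v"
  let ?m = "\<lambda>a \<omega>. MIN i\<in>{1..N}. e i a \<omega>"
  have "v \<le> V \<omega> \<longleftrightarrow> maxmin \<omega> \<le> ?y" for \<omega>
    using \<tau> by (simp add: V_def field_simps)
  then have "\<P>(\<omega> in P. v \<le> V \<omega>) = prob (\<Inter>a\<in>B. ?m a -` {..?y} \<inter> space P)"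
    using B unfolding maxmin_def by (intro arg_cong[where f=prob]) auto
  also have "\<dots> = (\<Prod>a\<in>B. prob (?m a -` {..?y} \<inter> space P))"
    using B by (intro indep_varsD[OF indep_mins]) auto
  also have "\<dots> = (\<Prod>a\<in>B. 1 - v ^ N)"
  proof (intro prod.cong refl)
    fix a assume "a \<in> B"
    have "prob (?m a -` {..?y} \<inter> space P) = \<P>(\<omega> in P. ?m a \<omega> \<le> ?y)"
      by (intro arg_cong[where f=prob]) auto
    then show "prob (?m a -` {..?y} \<inter> space P) = 1 - v ^ N"
      using prob_min_le[OF \<open>a \<in> B\<close> assms] by simp
  qed
  finally show ?thesis by simp
qed

text \<open>The tail formula at the endpoints: it gives 1 at \<open>v = 0\<close> because
  \<open>N\<close> is positive, and 0 at \<open>v = 1\<close> because \<open>B\<close> is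
  nonempty.\<close>

lemma AE_V: "AE \<omega> in P. 0 \<le> V \<omega> \<and> V \<omega> \<le> 1"
proof -
  have "AE \<omega> in P. 0 \<le> V \<omega>"
    using AE_prob_1[of "{\<omega> \<in> space P. 0 \<le> V \<omega>}"] prob_V_ge[of 0] N by (simp add: zero_power)
  moreover have "AE \<omega> in P. \<not> 1 \<le> V \<omega>"
    using prob_V_ge[of 1] B
    by (subst AE_iff_measurable[OF _ refl]) (auto simp: emeasure_eq_measure)
  ultimately show ?thesis by eventually_elim auto
qed

lemma integrable_V_power: "integrable P (\<lambda>\<omega>. V \<omega> ^ p)"
  by (rule integrable_power_unit_interval[OF measurable_V AE_V])

lemma expectation_V: "expectation V = t_MN (card B) N"
proof -
  obtain H where H: "\<And>v. (H has_real_derivative (1 - v ^ N) ^ card B) (at v)"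
    and H01: "H 1 - H 0 = t_MN (card B) N"
    using antiderivative_one_minus_power[OF N] by blast
  have "expectation (\<lambda>\<omega>. V \<omega> ^ Suc 0) = H 1 - H 0"
    by (rule expectation_power_tail[OF _ _ AE_V prob_V_ge]) (auto simp: H)
  then show ?thesis by (simp add: H01)
qed

lemma integrable_maxmin: "integrable P maxmin" "integrable P (\<lambda>\<omega>. (maxmin \<omega>)\<^sup>2)"
  using integrable_V_power[of 1] integrable_V_power[of 2]
  by (auto simp: maxmin_eq[abs_def] power2_diff power_mult_distrib)

lemma expectation_maxmin: "expectation maxmin = \<tau> * (1 - 2 * t_MN (card B) N)"
  using integrable_V_power[of 1]
  by (simp add: maxmin_eq[abs_def] expectation_V prob_space algebra_simps)

text \<open>\<open>maxmin\<close> is affine in \<open>V\<close> with slope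
  \<open>-2 * \<tau>\<close>, so its variance is \<open>(2 * \<tau>)\<^sup>2\<close> times that of
  \<open>V\<close>, which the first two moments of \<open>V\<close> determine.\<close>

lemma variance_min:
  assumes "card B = 1"
  shows "variance maxmin = 4 * real N * \<tau>\<^sup>2 / ((real N + 1)\<^sup>2 * (real N + 2))"
proof -
  have power: "((\<lambda>v. v ^ (N + 2)) has_real_derivative (real N + 2) * v ^ (N + 1)) (at v)" for v :: real
    using DERIV_pow[of "N + 2" v UNIV] by (simp add: add.commute)
  \<comment> \<open>Termwise antiderivative of \<open>2 * v * (1 - v ^ N)\<close>, the integrand of
    the second moment for a single action.\<close>
  define H where "H v = v\<^sup>2 - 2 / (real N + 2) * v ^ (N + 2)" for v :: real
  have "(H has_real_derivative 2 * v - 2 / (real N + 2) * ((real N + 2) * v ^ (N + 1))) (at v)" for v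
    unfolding H_def[abs_def] using DERIV_pow[of 2 v UNIV]
    by (intro DERIV_diff DERIV_cmult power) simp
  moreover have "2 * v - 2 / (real N + 2) * ((real N + 2) * v ^ (N + 1))
      = real (Suc 1) * v ^ 1 * (1 - v ^ N) ^ card B" for v
    by (simp add: assms right_diff_distrib)
  ultimately have "(H has_real_derivative real (Suc 1) * v ^ 1 * (1 - v ^ N) ^ card B) (at v)" for v
    by metis
  then have "expectation (\<lambda>\<omega>. V \<omega> ^ Suc 1) = H 1 - H 0"
    by (intro expectation_power_tail[OF _ _ AE_V prob_V_ge]) auto
  then have 2: "expectation (\<lambda>\<omega>. (V \<omega>)\<^sup>2) = real N / (real N + 2)"
    by (simp add: H_def field_simps numeral_2_eq_2)
  have 1: "expectation V = real N / (real N + 1)"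
    using N by (simp add: expectation_V assms t_MN_def field_simps)
  have "variance V = real N / (real N + 2) - (real N / (real N + 1))\<^sup>2"
    using integrable_V_power[of 1] integrable_V_power[of 2]
    by (subst variance_eq) (simp_all add: 1 2)
  moreover have "variance maxmin = expectation (\<lambda>\<omega>. (2 * \<tau>)\<^sup>2 * (V \<omega> - expectation V)\<^sup>2)"
    using integrable_V_power[of 1]
    by (intro Bochner_Integration.integral_cong)
       (auto simp: maxmin_eq[abs_def] prob_space power2_eq_square algebra_simps)
  ultimately have "variance maxmin = (2 * \<tau>)\<^sup>2 * (real N / (real N + 2) - (real N / (real N + 1))\<^sup>2)"
    by simp
  also have "\<dots> = 4 * real N * \<tau>\<^sup>2 / ((real N + 1)\<^sup>2 * (real N + 2))"
  proof -
    have "real N + 1 \<noteq> 0" "real N + 2 \<noteq> 0" by linarith+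
    then have "real N / (real N + 2) - (real N / (real N + 1))\<^sup>2 = real N / ((real N + 1)\<^sup>2 * (real N + 2))"
      by (simp add: divide_simps) (simp add: power2_eq_square algebra_simps)
    then show ?thesis by (simp add: power_mult_distrib)
  qed
  finally show ?thesis .
qed

end

section \<open>Dependence on the number of estimators\<close>

lemma t_MN_strict_mono:
  assumes "1 \<le> N" "N < N'" "M \<ge> 1"
  shows "t_MN M N < t_MN M N'"
proof -
  have less: "real k / (real k + 1 / real N) < real k / (real k + 1 / real N')" if "k \<in> {1..M}" for k
  proof -
    have "1 / real N' < 1 / real N" using assms by (simp add: field_simps)
    then show ?thesis
      using that assms by (intro divide_strict_left_mono mult_pos_pos add_pos_nonneg) auto
  qed
  show ?thesis
    unfolding t_MN_altdef
  \<comment> \<open>Every factor increases strictly; the index 1, present since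
    \<open>M \<ge> 1\<close>, serves as the strict one.\<close>
  proof (rule prod_mono_strict[of 1])
    fix k assume "k \<in> {1..M}"
    then show "0 \<le> real k / (real k + 1 / real N) \<and>
        real k / (real k + 1 / real N) \<le> real k / (real k + 1 / real N')"
      using less by (simp add: less_imp_le)
    show "0 < real k / (real k + 1 / real N')"
      using \<open>k \<in> {1..M}\<close> by (intro divide_pos_pos add_pos_nonneg) auto
  qed (use assms less[of 1] in auto)
qed

lemma t_MN_one: "t_MN M 1 = 1 / (real M + 1)"
proof (induction M)
  case (Suc M)
  then show ?case by (simp add: t_MN_altdef add.commute)
qed (simp add: t_MN_def)

lemma t_MN_tendsto: "(\<lambda>N. t_MN M N) \<longlonglongrightarrow> 1"
proof -
  have "(\<lambda>N. \<Prod>k=1..M. real k / (real k + 1 / real N)) \<longlonglongrightarrow> (\<Prod>k=1..M. real k / (real k + 0))"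
    by (intro tendsto_prod tendsto_intros lim_1_over_n) auto
  then show ?thesis by (simp add: t_MN_altdef)
qed

text \<open>After cross-multiplication the difference factors as
  \<open>(y - x) * (x * y * (x + y + 4) - 2)\<close>, and the second factor is at least 4 for
  arguments from 1 on.\<close>

lemma variance_formula_strict_antimono:
  fixes x y c :: real
  assumes "1 \<le> x" "x < y" "0 < c"
  shows "4 * y * c / ((y + 1)\<^sup>2 * (y + 2)) < 4 * x * c / ((x + 1)\<^sup>2 * (x + 2))"
proof -
  have "1 * 1 \<le> x * y" using assms by (intro mult_mono) auto
  then have "1 * 6 \<le> (x * y) * (x + y + 4)" using assms by (intro mult_mono) auto
  then have "0 < (y - x) * ((x * y) * (x + y + 4) - 2)" using assms by (intro mult_pos_pos) auto
  also have "\<dots> = x * ((y + 1)\<^sup>2 * (y + 2)) - y * ((x + 1)\<^sup>2 * (x + 2))"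
    by (simp add: algebra_simps power2_eq_square)
  finally have "y * ((x + 1)\<^sup>2 * (x + 2)) < x * ((y + 1)\<^sup>2 * (y + 2))" by simp
  moreover have "0 < (x + 1)\<^sup>2 * (x + 2)" "0 < (y + 1)\<^sup>2 * (y + 2)"
    using assms by (auto intro!: mult_pos_pos zero_less_power)
  ultimately have "y / ((y + 1)\<^sup>2 * (y + 2)) < x / ((x + 1)\<^sup>2 * (x + 2))"
    by (simp add: divide_less_eq less_divide_eq mult.commute)
  then have "(4 * c) * (y / ((y + 1)\<^sup>2 * (y + 2))) < (4 * c) * (x / ((x + 1)\<^sup>2 * (x + 2)))"
    using assms by (intro mult_strict_left_mono) auto
  then show ?thesis by (simp add: mult_ac)
qed

lemma variance_formula_tendsto:
  "(\<lambda>N. 4 * real N * c / ((real N + 1)\<^sup>2 * (real N + 2))) \<longlonglongrightarrow> 0"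
  by real_asymp

section \<open>Bias and variance of the maxmin estimate\<close>

context maxmin_estimates
begin

lemma uniform_errors:
  assumes "finite B" "B \<noteq> {}" "B \<subseteq> A s"
  shows "uniform_errors P \<tau> N B (\<lambda>i a. e i s a)"
proof
  show "indep_vars (\<lambda>_. borel) (\<lambda>(i, a). e i s a) ({1..N} \<times> B)"
    using assms by (intro indep_vars_subset[OF error_indep]) auto
qed (use assms N_pos \<tau>_pos error_uniform in auto)

lemma Qmin_eq:
  assumes "a \<in> A s" "\<omega> \<in> space P"
  shows "Qmin N Q s a \<omega> = Qstar s a + (MIN i\<in>{1..N}. e i s a \<omega>)"
proof -
  have "Qmin N Q s a \<omega> = (MIN i\<in>{1..N}. e i s a \<omega> + Qstar s a)"
    unfolding Qmin_def using assms by (auto intro!: arg_cong[where f=Min] image_cong simp: Q_eq)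
  also have "\<dots> = (MIN i\<in>{1..N}. e i s a \<omega>) + Qstar s a"
    using N_pos by (intro Min_add_commute) auto
  finally show ?thesis by simp
qed

text \<open>The common action value is a constant shift, so it leaves the first maximum and cancels
  against the second.\<close>

lemma estimation_bias_eq:
  assumes fin: "finite (A s')" "A s' \<noteq> {}"
    and same: "\<And>a b. a \<in> A s' \<Longrightarrow> b \<in> A s' \<Longrightarrow> Qstar s' a = Qstar s' b"
    and \<omega>: "\<omega> \<in> space P"
  shows "estimation_bias \<gamma> A Qstar r s' N Q \<omega> = \<gamma> * (MAX a\<in>A s'. MIN i\<in>{1..N}. e i s' a \<omega>)"
proof -
  obtain b where b: "b \<in> A s'" using fin by auto
  have *: "Qstar s' a = Qstar s' b" if "a \<in> A s'" for a using same that b by blast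
  have "(MAX a\<in>A s'. Qmin N Q s' a \<omega>) = (MAX a\<in>A s'. (MIN i\<in>{1..N}. e i s' a \<omega>) + Qstar s' b)"
    by (intro arg_cong[where f=Max] image_cong refl) (auto simp: Qmin_eq[OF _ \<omega>] *)
  also have "\<dots> = (MAX a\<in>A s'. MIN i\<in>{1..N}. e i s' a \<omega>) + Qstar s' b"
    using fin by (intro Max_add_commute) auto
  finally have 1: "(MAX a\<in>A s'. Qmin N Q s' a \<omega>) = \<dots>" .
  have "(MAX a\<in>A s'. Qstar s' a) = (MAX a\<in>A s'. Qstar s' b)"
    by (intro arg_cong[where f=Max] image_cong refl) (rule *)
  also have "\<dots> = Qstar s' b" using b by (simp add: image_constant)
  finally have 2: "(MAX a\<in>A s'. Qstar s' a) = Qstar s' b" .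
  show ?thesis unfolding estimation_bias_def 1 2 by (simp add: algebra_simps)
qed

lemma estimation_bias:
  assumes fin: "finite (A s')" "A s' \<noteq> {}"
    and same: "\<And>a b. a \<in> A s' \<Longrightarrow> b \<in> A s' \<Longrightarrow> Qstar s' a = Qstar s' b"
  shows integrable_estimation_bias: "integrable P (estimation_bias \<gamma> A Qstar r s' N Q)"
    and expectation_estimation_bias:
      "expectation (estimation_bias \<gamma> A Qstar r s' N Q) = \<gamma> * \<tau> * (1 - 2 * t_MN (card (A s')) N)"
proof -
  interpret U: uniform_errors P \<tau> N "A s'" "\<lambda>i a. e i s' a"
    using fin by (intro uniform_errors) auto
  have eq: "estimation_bias \<gamma> A Qstar r s' N Q \<omega> = \<gamma> * U.maxmin \<omega>" if "\<omega> \<in> space P" for \<omega>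
    unfolding U.maxmin_def by (rule estimation_bias_eq[OF fin same that])
  show "integrable P (estimation_bias \<gamma> A Qstar r s' N Q)"
    using U.integrable_maxmin(1)
    by (subst Bochner_Integration.integrable_cong[OF refl eq]) auto
  show "expectation (estimation_bias \<gamma> A Qstar r s' N Q) = \<gamma> * \<tau> * (1 - 2 * t_MN (card (A s')) N)"
    by (subst Bochner_Integration.integral_cong[OF refl eq]) (auto simp: U.expectation_maxmin)
qed

text \<open>With the single action \<open>a\<close>, \<open>Qmin\<close> is \<open>maxmin\<close>
  shifted by the constant \<open>Qstar s a\<close>, which does not affect the variance.\<close>

lemma Qmin_moments:
  assumes a: "a \<in> A s"
  shows integrable_Qmin: "integrable P (Qmin N Q s a)"
    and integrable_Qmin_square: "integrable P (\<lambda>\<omega>. (Qmin N Q s a \<omega>)\<^sup>2)"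
    and variance_Qmin: "variance (Qmin N Q s a) = 4 * real N * \<tau>\<^sup>2 / ((real N + 1)\<^sup>2 * (real N + 2))"
proof -
  interpret U: uniform_errors P \<tau> N "{a}" "\<lambda>i a. e i s a"
    using a by (intro uniform_errors) auto
  have eq: "Qmin N Q s a \<omega> = Qstar s a + U.maxmin \<omega>" if "\<omega> \<in> space P" for \<omega>
    unfolding U.maxmin_def using Qmin_eq[OF a that] by simp
  note int = U.integrable_maxmin
  show "integrable P (Qmin N Q s a)"
    using int by (subst Bochner_Integration.integrable_cong[OF refl eq]) auto
  have "integrable P (\<lambda>\<omega>. (Qstar s a + U.maxmin \<omega>)\<^sup>2)"
    using int by (simp add: power2_sum)
  then show "integrable P (\<lambda>\<omega>. (Qmin N Q s a \<omega>)\<^sup>2)"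
    by (rule Bochner_Integration.integrable_cong[OF refl, THEN iffD1, rotated]) (simp add: eq)
  have "expectation (Qmin N Q s a) = Qstar s a + expectation U.maxmin"
    using int by (subst Bochner_Integration.integral_cong[OF refl eq]) (auto simp: prob_space)
  then have "variance (Qmin N Q s a) = variance U.maxmin"
    by (intro Bochner_Integration.integral_cong) (auto simp: eq)
  then show "variance (Qmin N Q s a) = 4 * real N * \<tau>\<^sup>2 / ((real N + 1)\<^sup>2 * (real N + 2))"
    by (simp add: U.variance_min)
qed

end

text \<open>The locale enters as a predicate so that \<open>N\<close> can vary, and estimates with
  different \<open>N\<close> may live on different probability spaces. Integrability is asserted
  too, since the expectation of a non-integrable function defaults to 0. Strict decrease of the bias
  is claimed for \<open>\<gamma> > 0\<close>, as it vanishes identically at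
  \<open>\<gamma> = 0\<close>.\<close>

theorem theorem1:
  fixes \<gamma> \<tau> r :: real
    and A :: "'s \<Rightarrow> 'a set"
    and Qstar :: "'s \<Rightarrow> 'a \<Rightarrow> real"
    and s' :: 's
    and M :: nat
  assumes "0 \<le> \<gamma>" "\<gamma> \<le> 1"
    and "\<tau> > 0"
    and "finite (A s')" "A s' \<noteq> {}" "M = card (A s')"
    and "\<And>a b. a \<in> A s' \<Longrightarrow> b \<in> A s' \<Longrightarrow> Qstar s' a = Qstar s' b"
  shows
    \<comment> \<open>the two stated forms of the minimum estimate and of the bias\<close>
    "(\<forall>N (P :: 'w measure) Q e. maxmin_estimates P \<tau> A Qstar N Q e \<longrightarrow>
        (\<forall>\<omega>\<in>space P.
           (\<forall>s. \<forall>a\<in>A s. Qmin N Q s a \<omega> = Qstar s a + (MIN i\<in>{1..N}. e i s a \<omega>)) \<and>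
           estimation_bias \<gamma> A Qstar r s' N Q \<omega> =
             \<gamma> * ((MAX a'\<in>A s'. Qmin N Q s' a' \<omega>) - (MAX a'\<in>A s'. Qstar s' a'))))
     \<and>
     \<comment> \<open>(i)\<close>
     (\<forall>N (P :: 'w measure) Q e. maxmin_estimates P \<tau> A Qstar N Q e \<longrightarrow>
        integrable P (estimation_bias \<gamma> A Qstar r s' N Q) \<and>
        prob_space.expectation P (estimation_bias \<gamma> A Qstar r s' N Q) = \<gamma> * \<tau> * (1 - 2 * t_MN M N))
     \<and>
     (\<forall>N N' (P :: 'w measure) (P' :: 'w measure) Q Q' e e'.
        maxmin_estimates P \<tau> A Qstar N Q e \<longrightarrow> maxmin_estimates P' \<tau> A Qstar N' Q' e' \<longrightarrow> N < N' \<longrightarrow>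
        prob_space.expectation P' (estimation_bias \<gamma> A Qstar r s' N' Q') \<le>
          prob_space.expectation P (estimation_bias \<gamma> A Qstar r s' N Q) \<and>
        (\<gamma> > 0 \<longrightarrow>
          prob_space.expectation P' (estimation_bias \<gamma> A Qstar r s' N' Q') <
            prob_space.expectation P (estimation_bias \<gamma> A Qstar r s' N Q)))
     \<and>
     (\<forall>(P :: 'w measure) Q e. maxmin_estimates P \<tau> A Qstar 1 Q e \<longrightarrow>
        prob_space.expectation P (estimation_bias \<gamma> A Qstar r s' 1 Q) =
          \<gamma> * \<tau> * ((real M - 1) / (real M + 1)))
     \<and>
     (\<forall>(P :: nat \<Rightarrow> 'w measure) Q e.
        (\<forall>N\<ge>1. maxmin_estimates (P N) \<tau> A Qstar N (Q N) (e N)) \<longrightarrow>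
        (\<lambda>N. prob_space.expectation (P N) (estimation_bias \<gamma> A Qstar r s' N (Q N)))
          \<longlonglongrightarrow> - \<gamma> * \<tau>)
     \<and>
     \<comment> \<open>(ii)\<close>
     (\<forall>N (P :: 'w measure) Q e s. \<forall>a\<in>A s. maxmin_estimates P \<tau> A Qstar N Q e \<longrightarrow>
        integrable P (Qmin N Q s a) \<and> integrable P (\<lambda>\<omega>. (Qmin N Q s a \<omega>)\<^sup>2) \<and>
        prob_space.variance P (Qmin N Q s a) =
          4 * real N * \<tau>\<^sup>2 / ((real N + 1)\<^sup>2 * (real N + 2)))
     \<and>
     (\<forall>N N' (P :: 'w measure) (P' :: 'w measure) Q Q' e e' s. \<forall>a\<in>A s.
        maxmin_estimates P \<tau> A Qstar N Q e \<longrightarrow> maxmin_estimates P' \<tau> A Qstar N' Q' e' \<longrightarrow> N < N' \<longrightarrow>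
        prob_space.variance P' (Qmin N' Q' s a) < prob_space.variance P (Qmin N Q s a))
     \<and>
     (\<forall>(P :: 'w measure) Q e s. \<forall>a\<in>A s. maxmin_estimates P \<tau> A Qstar 1 Q e \<longrightarrow>
        prob_space.variance P (Qmin 1 Q s a) = \<tau>\<^sup>2 / 3)
     \<and>
     (\<forall>(P :: nat \<Rightarrow> 'w measure) Q e s. \<forall>a\<in>A s.
        (\<forall>N\<ge>1. maxmin_estimates (P N) \<tau> A Qstar N (Q N) (e N)) \<longrightarrow>
        (\<lambda>N. prob_space.variance (P N) (Qmin N (Q N) s a)) \<longlonglongrightarrow> 0)"
proof -
  note fin = assms(4,5) and same = assms(7) and M = assms(6)
  have M1: "M \<ge> 1" using fin M by (simp add: Suc_leI card_gt_0_iff)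
  have exp: "prob_space.expectation P (estimation_bias \<gamma> A Qstar r s' N Q) = \<gamma> * \<tau> * (1 - 2 * t_MN M N)"
    if "maxmin_estimates P \<tau> A Qstar N Q e" for N and P :: "'w measure" and Q e
    using maxmin_estimates.expectation_estimation_bias[OF that fin same] M by simp
  note var = maxmin_estimates.variance_Qmin
  have N1: "N \<ge> 1" if "maxmin_estimates P \<tau> A Qstar N Q e" for N and P :: "'w measure" and Q e
    using that by (rule maxmin_estimates.N_pos)
  have mono: "\<gamma> * \<tau> * (1 - 2 * t_MN M N') \<le> \<gamma> * \<tau> * (1 - 2 * t_MN M N) \<and>
      (\<gamma> > 0 \<longrightarrow> \<gamma> * \<tau> * (1 - 2 * t_MN M N') < \<gamma> * \<tau> * (1 - 2 * t_MN M N))"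
    if "1 \<le> N" "N < N'" for N N'
    using t_MN_strict_mono[OF that M1] assms(1,3)
    by (auto intro!: mult_left_mono)
  have one: "1 - 2 * t_MN M 1 = (real M - 1) / (real M + 1)"
    by (simp add: t_MN_one[simplified] field_simps)
  have lim: "(\<lambda>N. \<gamma> * \<tau> * (1 - 2 * t_MN M N)) \<longlonglongrightarrow> - \<gamma> * \<tau>"
    by (rule tendsto_eq_rhs[OF tendsto_mult_left[OF tendsto_diff[OF tendsto_const
        tendsto_mult_left[OF t_MN_tendsto]]]]) simp
  \<comment> \<open>The closed forms are available only from \<open>N = 1\<close> on, which suffices
    for limits.\<close>
  have conv: "f \<longlonglongrightarrow> l" if "\<forall>N\<ge>1. f N = g N" "g \<longlonglongrightarrow> l" for f g :: "nat \<Rightarrow> real" and l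
    using that by (subst tendsto_cong[of f g]) (auto simp: eventually_sequentially)
  show ?thesis
  proof (intro conjI allI ballI impI, goal_cases)
    case (1 N P Q e \<omega> s a)
    then show ?case by (intro maxmin_estimates.Qmin_eq)
  next
    case (2 N P Q e \<omega>)
    show ?case by (simp add: estimation_bias_def algebra_simps)
  next
    case (3 N P Q e)
    from maxmin_estimates.integrable_estimation_bias[OF this fin same] show ?case .
  next
    case (4 N P Q e)
    then show ?case by (rule exp)
  next
    case (5 N N' P P' Q Q' e e')
    then show ?case using mono[OF N1[OF 5(1)] 5(3)] by (simp add: exp[OF 5(1)] exp[OF 5(2)])
  next
    case (6 N N' P P' Q Q' e e')
    then show ?case using mono[OF N1[OF 6(1)] 6(3)] by (simp add: exp[OF 6(1)] exp[OF 6(2)])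
  next
    case (7 P Q e)
    then show ?case by (simp only: exp one)
  next
    case (8 P Q e)
    then have "maxmin_estimates (P N) \<tau> A Qstar N (Q N) (e N)" if "1 \<le> N" for N
      using that by simp
    from exp[OF this] show ?case
      by (intro conv[OF _ lim]) simp
  next
    case (9 N P Q e s a)
    then show ?case by (intro maxmin_estimates.integrable_Qmin)
  next
    case (10 N P Q e s a)
    then show ?case by (intro maxmin_estimates.integrable_Qmin_square)
  next
    case (11 N P Q e s a)
    then show ?case by (intro var)
  next
    case (12 N N' P P' Q Q' e e' s a)
    show ?case
      unfolding var[OF 12(2,1)] var[OF 12(3,1)]
      using N1[OF 12(2)] 12(4) assms(3) by (intro variance_formula_strict_antimono) auto
  next
    case (13 P Q e s a)
    show ?case unfolding var[OF 13(2,1)] by simp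
  next
    case (14 P Q e s a)
    then have "maxmin_estimates (P N) \<tau> A Qstar N (Q N) (e N)" if "1 \<le> N" for N
      using that by simp
    from var[OF this 14(1)] show ?case
      by (intro conv[OF _ variance_formula_tendsto[of "\<tau>\<^sup>2"]]) simp
  qed
qed

end
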